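(* For every integer $N \geq 2$, the Dehn function $\partial_N$ of the one-relation monoid $$\Pi_N = \mathrm{Mon}\langle a,b \mid baa(ba)^N = a\rangle$$ (with respect to this presentation) satisfies $\partial_N(n) \succeq N^{n/4}$; that is, the Dehn function of $\Pi_N$ is at least exponential.
   Context: $\mathrm{Mon}\langle A \mid u=v\rangle$ denotes the quotient of the free monoid $A^\ast$ by the least congruence containing $(u,v)$. An elementary transformation is a single application of the defining relation: it replaces a word $pus$ by $pvs$ or $pvs$ by $pus$, for some $p,s\in A^\ast$. For words $u,v$ equal in a finitely presented monoid $M$ with generating set $A$, $\partial_M(u,v)$ is the length of a shortest sequence of elementary transformations transforming $u$ into $v$. The Dehn function is $\partial_M(n)=\max\{\partial_M(u,v) : u,v\in A^\ast,\ u=_M v,\ |u|+|v|\le n\}$, where $|\cdot|$ is word length. For functions $\varphi,\psi$ on $\mathbb{N}$ with non-negative values, $\varphi\preceq\psi$ means there is a constant $c\in\mathbb{N}$ with $\varphi(n)\le c\,\psi(cn)+cn$ for all $n\in\mathbb{N}$; $\psi\succeq\varphi$ means $\varphi\preceq\psi$. *)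

theory Defs
  imports Complex_Main
begin

text \<open>A presentation over the alphabet \<open>'a\<close> is given by its set of defining relations; words are
  lists, and the empty list is the empty word.\<close>

type_synonym 'a presentation = "('a list \<times> 'a list) set"

text \<open>The least congruence on the free monoid containing the defining relations. The monoid is the
  quotient by it, so words are equal in the monoid iff they are related here.\<close>

inductive_set mon_eq :: "'a presentation \<Rightarrow> ('a list \<times> 'a list) set"
  for R :: "'a presentation" where
  base: "(u, v) \<in> R \<Longrightarrow> (u, v) \<in> mon_eq R"
| refl: "(w, w) \<in> mon_eq R"
| sym: "(u, v) \<in> mon_eq R \<Longrightarrow> (v, u) \<in> mon_eq R"
| trans: "(u, v) \<in> mon_eq R \<Longrightarrow> (v, w) \<in> mon_eq R \<Longrightarrow> (u, w) \<in> mon_eq R"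
| mult: "(u, v) \<in> mon_eq R \<Longrightarrow> (u', v') \<in> mon_eq R \<Longrightarrow> (u @ u', v @ v') \<in> mon_eq R"

definition elem_trans :: "'a presentation \<Rightarrow> ('a list \<times> 'a list) set" where
  "elem_trans R = {(x, y). \<exists>p s u v. ((u, v) \<in> R \<or> (v, u) \<in> R) \<and> x = p @ u @ s \<and> y = p @ v @ s}"

text \<open>Only meaningful for words equal in the monoid; see \<open>mon_eq_iff_elem_trans\<close> below.\<close>

definition deriv_dist :: "'a presentation \<Rightarrow> 'a list \<Rightarrow> 'a list \<Rightarrow> nat" where
  "deriv_dist R u v = (LEAST k. (u, v) \<in> elem_trans R ^^ k)"

definition dehn :: "('a::finite) presentation \<Rightarrow> nat \<Rightarrow> nat" where
  "dehn R n = Max {deriv_dist R u v | u v. (u, v) \<in> mon_eq R \<and> length u + length v \<le> n}"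

text \<open>The natural numbers start at 1 here. The bound cannot be required at \<open>n = 0\<close>: every Dehn
  function vanishes there, so no function positive at 0 would lie below a Dehn function.\<close>

definition dominated_by :: "(nat \<Rightarrow> real) \<Rightarrow> (nat \<Rightarrow> real) \<Rightarrow> bool" (infix \<open>\<preceq>\<close> 50) where
  "\<phi> \<preceq> \<psi> \<longleftrightarrow> (\<exists>c::nat. c \<ge> 1 \<and> (\<forall>n::nat. n \<ge> 1 \<longrightarrow> \<phi> n \<le> real c * \<psi> (c * n) + real (c * n)))"

abbreviation dominates :: "(nat \<Rightarrow> real) \<Rightarrow> (nat \<Rightarrow> real) \<Rightarrow> bool" (infix \<open>\<succeq>\<close> 50) where
  "\<psi> \<succeq> \<phi> \<equiv> \<phi> \<preceq> \<psi>"

datatype letter = La | Lb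

instance letter :: finite
proof
  have "(UNIV :: letter set) = {La, Lb}"
    using letter.exhaust by blast
  then show "finite (UNIV :: letter set)"
    by (metis finite.emptyI finite_insert)
qed

definition Pi_pres :: "nat \<Rightarrow> letter presentation" where
  "Pi_pres N = {([Lb, La, La] @ concat (replicate N [Lb, La]), [La])}"


text \<open>The minimum in \<open>deriv_dist\<close> and the maximum in \<open>dehn\<close> are attained.\<close>

lemma elem_trans_append:
  assumes "(x, y) \<in> elem_trans R"
  shows "(p @ x @ s, p @ y @ s) \<in> elem_trans R"
proof -
  obtain p' s' u v where "(u, v) \<in> R \<or> (v, u) \<in> R" "x = p' @ u @ s'" "y = p' @ v @ s'"
    using assms unfolding elem_trans_def by blast
  then have "p @ x @ s = (p @ p') @ u @ (s' @ s) \<and> p @ y @ s = (p @ p') @ v @ (s' @ s)"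
    by simp
  with \<open>(u, v) \<in> R \<or> (v, u) \<in> R\<close> show ?thesis
    unfolding elem_trans_def by blast
qed

lemma elem_trans_rtrancl_append:
  assumes "(x, y) \<in> (elem_trans R)\<^sup>*"
  shows "(p @ x @ s, p @ y @ s) \<in> (elem_trans R)\<^sup>*"
  using assms
  by (induction rule: rtrancl_induct) (auto intro: elem_trans_append rtrancl_into_rtrancl)

lemma sym_elem_trans: "sym (elem_trans R)"
  unfolding sym_def elem_trans_def by blast

lemma mon_eq_eq_rtrancl: "mon_eq R = (elem_trans R)\<^sup>*"
proof (intro equalityI subrelI)
  fix x y assume "(x, y) \<in> mon_eq R"
  then show "(x, y) \<in> (elem_trans R)\<^sup>*"
  proof induction
    case (base u v)
    then have "(u, v) \<in> elem_trans R"
      unfolding elem_trans_def by (force intro: exI[of _ "[]"])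
    then show ?case by blast
  next
    case (sym u v)
    then show ?case
      using sym_rtrancl[OF sym_elem_trans] by (meson symD)
  next
    case (mult u v u' v')
    have "(u @ u', v @ u') \<in> (elem_trans R)\<^sup>*"
      using elem_trans_rtrancl_append[OF mult.IH(1), of "[]" u'] by simp
    moreover have "(v @ u', v @ v') \<in> (elem_trans R)\<^sup>*"
      using elem_trans_rtrancl_append[OF mult.IH(2), of v "[]"] by simp
    ultimately show ?case by (rule rtrancl_trans)
  qed (auto intro: rtrancl_trans)
next
  fix x y assume "(x, y) \<in> (elem_trans R)\<^sup>*"
  then show "(x, y) \<in> mon_eq R"
  proof (induction rule: rtrancl_induct)
    case base
    show ?case by (rule mon_eq.refl)
  next
    case (step y z)
    obtain p s u v where "(u, v) \<in> R \<or> (v, u) \<in> R" and yz: "y = p @ u @ s" "z = p @ v @ s"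
      using step.hyps(2) unfolding elem_trans_def by blast
    then have "(u, v) \<in> mon_eq R"
      by (auto intro: mon_eq.base mon_eq.sym)
    then have "(y, z) \<in> mon_eq R"
      unfolding yz by (intro mon_eq.mult mon_eq.refl)
    with step.IH show ?case by (rule mon_eq.trans)
  qed
qed

lemma mon_eq_iff_elem_trans: "(u, v) \<in> mon_eq R \<longleftrightarrow> (\<exists>k. (u, v) \<in> elem_trans R ^^ k)"
  by (simp add: mon_eq_eq_rtrancl rtrancl_power)

lemma finite_dehn_set:
  fixes R :: "('a::finite) presentation"
  shows "finite {deriv_dist R u v | u v. (u, v) \<in> mon_eq R \<and> length u + length v \<le> n}"
proof (rule finite_subset)
  let ?W = "{w :: 'a list. set w \<subseteq> UNIV \<and> length w \<le> n}"
  show "{deriv_dist R u v | u v. (u, v) \<in> mon_eq R \<and> length u + length v \<le> n}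
      \<subseteq> (\<lambda>(u, v). deriv_dist R u v) ` (?W \<times> ?W)"
    by force
  show "finite ((\<lambda>(u, v). deriv_dist R u v) ` (?W \<times> ?W))"
    by (intro finite_imageI finite_cartesian_product finite_lists_length_le finite)
qed

lemma nonempty_dehn_set:
  "{deriv_dist R u v | u v. (u, v) \<in> mon_eq R \<and> length u + length v \<le> n} \<noteq> {}"
  using mon_eq.refl[of "[]" R] by force

end

theory Submission
  imports Defs
begin

text \<open>Put \<open>t = ba\<close>, so that the relation reads \<open>t a t\<^sup>N = a\<close>. In the monoid
  \<open>w = b\<^sup>2\<^sup>k\<^sup>+\<^sup>1 a\<^sup>2\<^sup>k\<^sup>+\<^sup>1\<close> equals a power of \<open>t\<close>, hence \<open>w t = t w\<close>. For the lower bound, pass to the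
  group \<open>BS(1, -N)\<close>, acting on the line by \<open>t y = y + 1\<close> and \<open>a y = - y / N\<close>. On its Cayley graph
  take the 1-cochain that vanishes except on the \<open>a\<close>-edges entering level 0 from the one branch
  of the Bass-Serre tree that the path of \<open>w\<close> runs through, where it is the coordinate along the
  branch. Its coboundary is bounded by \<open>N\<close>, so an elementary transformation changes its
  integral along a word by at most \<open>N\<close>, whereas the integrals along \<open>w t\<close> and \<open>t w\<close> differ by about
  \<open>N\<^sup>2\<^sup>k\<close>.\<close>

section \<open>Equalities in the monoid: odd peaks commute with \<open>ba\<close>\<close>

definition ba_pow :: "nat \<Rightarrow> letter list" where
  "ba_pow n = concat (replicate n [Lb, La])"

lemma ba_pow_0 [simp]: "ba_pow 0 = []"
  and ba_pow_Suc [simp]: "ba_pow (Suc n) = Lb # La # ba_pow n"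
  by (simp_all add: ba_pow_def)

lemma ba_pow_add: "ba_pow (m + n) = ba_pow m @ ba_pow n"
  by (induction m) auto

lemma mon_eq_cong:
  assumes "(u, v) \<in> mon_eq R"
  shows "(p @ u @ s, p @ v @ s) \<in> mon_eq R"
  by (intro mon_eq.mult mon_eq.refl assms)

lemma Pi_relation: "([Lb, La, La] @ ba_pow N, [La]) \<in> mon_eq (Pi_pres N)"
  by (rule mon_eq.base) (simp add: Pi_pres_def ba_pow_def)

lemma ba_pow_absorb: "(ba_pow m @ [La] @ ba_pow (N * m), [La]) \<in> mon_eq (Pi_pres N)"
proof (induction m)
  case 0
  show ?case by (simp add: mon_eq.refl)
next
  case (Suc m)
  have "ba_pow (Suc m) = ba_pow m @ [Lb, La]"
    using ba_pow_add[of m 1] by simp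
  then have "(ba_pow (Suc m) @ [La] @ ba_pow (N * Suc m), ba_pow m @ [La] @ ba_pow (N * m))
      \<in> mon_eq (Pi_pres N)"
    using mon_eq_cong[OF Pi_relation, of "ba_pow m" N "ba_pow (N * m)"] by (simp add: ba_pow_add)
  then show ?case using Suc.IH by (rule mon_eq.trans)
qed

text \<open>Passing one \<open>a\<close> would make the exponent of \<open>t\<close> negative;
  passing two makes it positive again, so \<open>aa\<close> can be crossed within the
  monoid.\<close>

lemma ba_pow_commute_aa:
  "(ba_pow m @ [La, La], [La, La] @ ba_pow (N * N * m)) \<in> mon_eq (Pi_pres N)"
proof -
  have "(ba_pow m @ [La, La], ba_pow m @ [La] @ ba_pow (N * m) @ [La] @ ba_pow (N * (N * m)))
      \<in> mon_eq (Pi_pres N)"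
    using mon_eq_cong[OF mon_eq.sym[OF ba_pow_absorb[of "N * m" N]], of "ba_pow m @ [La]" "[]"]
    by simp
  moreover have "(ba_pow m @ [La] @ ba_pow (N * m) @ [La] @ ba_pow (N * (N * m)),
      [La, La] @ ba_pow (N * N * m)) \<in> mon_eq (Pi_pres N)"
    using mon_eq_cong[OF ba_pow_absorb[of m N], of "[]" "[La] @ ba_pow (N * (N * m))"]
    by (simp add: mult.assoc)
  ultimately show ?thesis by (rule mon_eq.trans)
qed

text \<open>Once \<open>aa\<close> has been moved to the left, the relation consumes
  \<open>N\<close> copies of \<open>t\<close> and reduces \<open>bbaa\<close> to
  \<open>ba\<close>.\<close>

lemma bb_ba_pow_aa:
  assumes "N * N * m = N + d"
  shows "([Lb, Lb] @ ba_pow m @ [La, La], ba_pow (Suc d)) \<in> mon_eq (Pi_pres N)"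
proof -
  have "([Lb, Lb] @ ba_pow m @ [La, La], [Lb, Lb, La, La] @ ba_pow (N + d)) \<in> mon_eq (Pi_pres N)"
    using mon_eq_cong[OF ba_pow_commute_aa[of m N], of "[Lb, Lb]" "[]"] assms by simp
  moreover have "([Lb, Lb, La, La] @ ba_pow (N + d), ba_pow (Suc d)) \<in> mon_eq (Pi_pres N)"
    using mon_eq_cong[OF Pi_relation[of N], of "[Lb]" "ba_pow d"] by (simp add: ba_pow_add)
  ultimately show ?thesis by (rule mon_eq.trans)
qed

definition peak :: "nat \<Rightarrow> letter list" where
  "peak j = replicate j Lb @ replicate j La"

text \<open>Each induction step adds two letters at both ends. A positive exponent
  \<open>Suc m\<close> guarantees the \<open>N\<close> copies of \<open>t\<close> that the relation
  consumes.\<close>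

lemma peak_odd_eq_ba_pow:
  assumes "N \<ge> 1"
  shows "\<exists>m. (peak (2 * k + 1), ba_pow (Suc m)) \<in> mon_eq (Pi_pres N)"
proof (induction k)
  case 0
  have "peak (2 * 0 + 1) = ba_pow (Suc 0)"
    by (simp add: peak_def)
  then show ?case by (metis mon_eq.refl)
next
  case (Suc k)
  then obtain m where m: "(peak (2 * k + 1), ba_pow (Suc m)) \<in> mon_eq (Pi_pres N)"
    by blast
  have "N * 1 \<le> N * (N * Suc m)"
    using assms by (intro mult_le_mono2) simp
  then have "N \<le> N * N * Suc m"
    by (simp only: mult.assoc mult_1_right)
  then obtain d where "N * N * Suc m = N + d"
    using le_Suc_ex by blast
  moreover have "peak (2 * Suc k + 1) = [Lb, Lb] @ peak (2 * k + 1) @ [La, La]"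
    by (simp add: peak_def replicate_app_Cons_same)
  ultimately have "(peak (2 * Suc k + 1), ba_pow (Suc d)) \<in> mon_eq (Pi_pres N)"
    using mon_eq.trans[OF mon_eq_cong[OF m] bb_ba_pow_aa] by metis
  then show ?case by blast
qed

lemma ba_commutes_peak_odd:
  assumes "N \<ge> 1"
  shows "([Lb, La] @ peak (2 * k + 1), peak (2 * k + 1) @ [Lb, La]) \<in> mon_eq (Pi_pres N)"
proof -
  obtain m where m: "(peak (2 * k + 1), ba_pow m) \<in> mon_eq (Pi_pres N)"
    using peak_odd_eq_ba_pow[OF assms] by blast
  have "[Lb, La] @ ba_pow m = ba_pow m @ [Lb, La]"
    using ba_pow_add[of m 1] ba_pow_add[of 1 m] by simp
  then show ?thesis
    using mon_eq_cong[OF m, of "[Lb, La]" "[]"] mon_eq_cong[OF m, of "[]" "[Lb, La]"]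
    by (metis append_Nil append_Nil2 mon_eq.sym mon_eq.trans)
qed

section \<open>The weighted Cayley graph and its bounded coboundary\<close>

text \<open>The state \<open>(x, m)\<close> stands for the affine map \<open>y \<mapsto> x + (-1/N)\<^sup>m y\<close>; a letter multiplies it on
  the right, where \<open>b = t a\<^sup>-\<^sup>1\<close>. An edge labelled \<open>b\<close> is thus a \<open>t\<close>-edge, of weight 0, followed by an
  \<open>a\<close>-edge traversed backwards.\<close>

fun act :: "nat \<Rightarrow> real \<times> int \<Rightarrow> letter \<Rightarrow> real \<times> int" where
  "act N (x, m) La = (x, m + 1)"
| "act N (x, m) Lb = (x + (- 1 / real N) powi m, m - 1)"

text \<open>At level -1, \<open>t\<close> shifts the coordinate by \<open>-N\<close>, so a residue
  class of integers modulo \<open>N\<close> is one vertex of the tree. The class of 1 is the one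
  that \<open>b\<close> reaches from \<open>(0, 0)\<close>.\<close>

definition a_weight :: "nat \<Rightarrow> real \<times> int \<Rightarrow> real" where
  "a_weight N s = (if snd s = -1 \<and> (\<exists>i::int. fst s = 1 + real N * i) then fst s else 0)"

fun weight :: "nat \<Rightarrow> real \<times> int \<Rightarrow> letter \<Rightarrow> real" where
  "weight N s La = a_weight N s"
| "weight N s Lb = - a_weight N (act N s Lb)"

fun potential :: "nat \<Rightarrow> real \<times> int \<Rightarrow> letter list \<Rightarrow> real" where
  "potential N s [] = 0"
| "potential N s (l # w) = weight N s l + potential N (act N s l) w"

lemma potential_append:
  "potential N s (u @ v) = potential N s u + potential N (foldl (act N) s u) v"
  by (induction u arbitrary: s) auto

text \<open>The letter \<open>b\<close> crosses an \<open>a\<close>-edge backwards and the following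
  \<open>a\<close> crosses the same edge forwards, so the weights cancel.\<close>

lemma potential_ba [simp]: "potential N s (Lb # La # w) = potential N (act N (act N s Lb) La) w"
  by simp

lemma foldl_act_ba_pow:
  "foldl (act N) (x, m) (ba_pow n) = (x + real n * (- 1 / real N) powi m, m)"
  by (induction n arbitrary: x) (auto simp: algebra_simps)

lemma potential_ba_pow: "potential N s (ba_pow n) = 0"
  by (induction n arbitrary: s) (simp_all del: potential.simps(2))

lemma foldl_act_relator:
  assumes "N \<ge> 1"
  shows "foldl (act N) s ([Lb, La, La] @ ba_pow N) = foldl (act N) s [La]"
proof (cases s)
  case (Pair x m)
  \<comment> \<open>The final \<open>N\<close> copies of \<open>t\<close>, read one level higher,
    undo the shift by the first \<open>t\<close>.\<close>
  have "real N * (- 1 / real N) powi (m + 1) = - ((- 1 / real N) powi m)"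
    using assms by (simp add: power_int_add_1)
  then show ?thesis
    by (simp add: Pair foldl_act_ba_pow)
qed

text \<open>After cancellation two parallel \<open>a\<close>-edges remain, one \<open>t\<close>-step
  apart. At level -1 this step is \<open>-N\<close>, so both or neither lie in the chosen class, and
  the weights differ by \<open>N\<close> or 0.\<close>

lemma potential_relator:
  assumes "N \<ge> 1"
  shows "\<bar>potential N s ([Lb, La, La] @ ba_pow N) - potential N s [La]\<bar> \<le> real N"
proof (cases s)
  case (Pair x m)
  have eq: "potential N s ([Lb, La, La] @ ba_pow N) - potential N s [La]
      = a_weight N (x + (- 1 / real N) powi m, m) - a_weight N (x, m)"
    by (simp add: Pair potential_ba_pow)
  show ?thesis
  proof (cases "m = -1")
    case True
    have "(- 1 / real N) powi m = - real N"
      using True assms by (simp add: power_int_minus)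
    moreover have "(\<exists>i::int. x - real N = 1 + real N * i) \<longleftrightarrow> (\<exists>i::int. x = 1 + real N * i)"
    proof (intro iffI; elim exE)
      fix i :: int assume "x - real N = 1 + real N * i"
      then have "x = 1 + real N * of_int (i + 1)" by (simp add: algebra_simps)
      then show "\<exists>i::int. x = 1 + real N * i" by blast
    next
      fix i :: int assume "x = 1 + real N * i"
      then have "x - real N = 1 + real N * of_int (i - 1)" by (simp add: algebra_simps)
      then show "\<exists>i::int. x - real N = 1 + real N * i" by blast
    qed
    ultimately show ?thesis
      unfolding eq a_weight_def by (simp only: fst_conv snd_conv True) simp
  next
    case False
    then show ?thesis
      unfolding eq by (simp add: a_weight_def)
  qed
qed

lemma potential_elem_trans:
  assumes "N \<ge> 1" "(u, v) \<in> elem_trans (Pi_pres N)"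
  shows "\<bar>potential N s u - potential N s v\<bar> \<le> real N"
proof -
  obtain p q where "(u, v) = (p @ ([Lb, La, La] @ ba_pow N) @ q, p @ [La] @ q)
      \<or> (v, u) = (p @ ([Lb, La, La] @ ba_pow N) @ q, p @ [La] @ q)"
    using assms(2) unfolding elem_trans_def Pi_pres_def ba_pow_def by blast
  moreover have "\<bar>potential N s (p @ ([Lb, La, La] @ ba_pow N) @ q) - potential N s (p @ [La] @ q)\<bar>
      \<le> real N"
    unfolding potential_append[of N _ p] potential_append[of N _ _ q] foldl_act_relator[OF assms(1)]
    using potential_relator[OF assms(1), of "foldl (act N) s p"] by linarith
  ultimately show ?thesis
    by (metis Pair_inject abs_minus_commute)
qed

lemma potential_elem_trans_power:
  assumes "N \<ge> 1" "(u, v) \<in> elem_trans (Pi_pres N) ^^ n"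
  shows "\<bar>potential N s u - potential N s v\<bar> \<le> real N * real n"
  using assms(2)
proof (induction n arbitrary: v)
  case (Suc n)
  then obtain w where w: "(u, w) \<in> elem_trans (Pi_pres N) ^^ n" "(w, v) \<in> elem_trans (Pi_pres N)"
    by auto
  have "\<bar>potential N s u - potential N s v\<bar>
      \<le> \<bar>potential N s u - potential N s w\<bar> + \<bar>potential N s w - potential N s v\<bar>"
    by simp
  also have "\<dots> \<le> real N * real n + real N"
    by (intro add_mono Suc.IH w potential_elem_trans assms)
  finally show ?case by (simp add: algebra_simps)
qed simp

lemma potential_deriv_dist:
  assumes "N \<ge> 1" "(u, v) \<in> mon_eq (Pi_pres N)"
  shows "\<bar>potential N s u - potential N s v\<bar> \<le> real N * real (deriv_dist (Pi_pres N) u v)"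
proof -
  have "(u, v) \<in> elem_trans (Pi_pres N) ^^ deriv_dist (Pi_pres N) u v"
    unfolding deriv_dist_def using assms(2) by (auto simp: mon_eq_iff_elem_trans intro: LeastI)
  then show ?thesis
    by (rule potential_elem_trans_power[OF assms(1)])
qed

section \<open>Potentials along the two commuting words\<close>

lemma foldl_act_replicate_a: "foldl (act N) (x, m) (replicate i La) = (x, m + int i)"
  by (induction i arbitrary: m) auto

lemma foldl_act_replicate_b:
  "foldl (act N) (x, - int m) (replicate i Lb)
    = (x + of_int (\<Sum>r<i. (- int N) ^ (m + r)), - int (m + i))"
proof (induction i arbitrary: x m)
  case (Suc i)
  have "inverse (- 1 / real N) = - real N"
    by simp
  then have pow: "(- 1 / real N) powi (- int m) = (- real N) ^ m"
    by (metis power_int_minus power_int_of_nat power_inverse)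
  have "foldl (act N) (x, - int m) (replicate (Suc i) Lb)
      = foldl (act N) (x + (- real N) ^ m, - int (Suc m)) (replicate i Lb)"
    by (simp only: replicate_Suc foldl_Cons act.simps pow of_nat_Suc minus_add_distrib
        add.commute diff_conv_add_uminus)
  also have "\<dots> = (x + of_int (\<Sum>r<Suc i. (- int N) ^ (m + r)), - int (m + Suc i))"
    unfolding Suc.IH by (simp add: sum.lessThan_Suc_shift del: sum.lessThan_Suc)
  finally show ?case .
qed simp

lemma potential_replicate_a:
  assumes "m + int i < 0"
  shows "potential N (x, m) (replicate i La) = 0"
  using assms by (induction i arbitrary: m) (auto simp: a_weight_def)

lemma potential_replicate_b:
  assumes "m < 0"
  shows "potential N (x, m) (replicate i Lb) = 0"
  using assms by (induction i arbitrary: x m) (auto simp: a_weight_def)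

text \<open>The coordinate reached from \<open>(0, 0)\<close> by \<open>j\<close> letters
  \<open>b\<close>; integral so that divisibility by \<open>N\<close> makes sense.\<close>

definition peak_shift :: "nat \<Rightarrow> nat \<Rightarrow> int" where
  "peak_shift N j = (\<Sum>r<j. (- int N) ^ r)"

text \<open>Only the first \<open>b\<close> and the last \<open>a\<close> cross between levels 0 and
  -1; the rest of the path stays below, where all weights vanish.\<close>

lemma potential_peak:
  "potential N (x, 0) (peak (Suc j))
    = a_weight N (x + peak_shift N (Suc j), -1) - a_weight N (x + 1, -1)"
proof -
  have split: "peak (Suc j) = [Lb] @ replicate j Lb @ replicate j La @ [La]"
    by (simp add: peak_def replicate_append_same)
  have "foldl (act N) (x + 1, - 1) (replicate j Lb) = (x + peak_shift N (Suc j), -1 - int j)"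
    using foldl_act_replicate_b[of N x 0 "Suc j"] by (simp add: peak_shift_def)
  then show ?thesis
    unfolding split potential_append
    by (simp add: potential_replicate_a potential_replicate_b foldl_act_replicate_a)
qed

lemma peak_shift_Suc: "peak_shift N (Suc j) = 1 - int N * peak_shift N j"
  unfolding peak_shift_def
  by (simp add: sum.lessThan_Suc_shift sum_distrib_left del: sum.lessThan_Suc)
     (simp add: sum_negf)

lemma peak_shift_odd: "(int N + 1) * peak_shift N (2 * k + 1) = int N ^ (2 * k + 1) + 1"
proof (induction k)
  case 0
  show ?case by (simp add: peak_shift_def)
next
  case (Suc k)
  have "peak_shift N (2 * Suc k + 1) = 1 - int N + int N * int N * peak_shift N (2 * k + 1)"
    using peak_shift_Suc[of N "2 * k + 1"] peak_shift_Suc[of N "2 * k + 2"]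
    by (simp add: right_diff_distrib mult.assoc)
  then have "(int N + 1) * peak_shift N (2 * Suc k + 1)
      = (int N + 1) * (1 - int N) + int N * int N * ((int N + 1) * peak_shift N (2 * k + 1))"
    by (simp only: distrib_left mult.left_commute)
  then show ?case
    unfolding Suc.IH by (simp add: algebra_simps)
qed

lemma a_weight_int:
  "a_weight N (of_int z, -1) = (if int N dvd z - 1 then of_int z else 0)"
proof -
  have "real_of_int z = 1 + real N * of_int i \<longleftrightarrow> z = 1 + int N * i" for i
    using of_int_eq_iff[of z "1 + int N * i", where 'a = real] by simp
  then have "(\<exists>i::int. real_of_int z = 1 + real N * i) \<longleftrightarrow> (\<exists>i. z = 1 + int N * i)"
    by simp
  also have "\<dots> \<longleftrightarrow> int N dvd z - 1"
    by (simp add: dvd_def diff_eq_eq add.commute)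
  finally show ?thesis
    by (simp add: a_weight_def)
qed

text \<open>From coordinate 0 both crossings have coordinates congruent to 1 modulo
  \<open>N\<close>. From coordinate 1 they are congruent to 2, a different class since
  \<open>N \<ge> 2\<close>, and contribute nothing.\<close>

lemma potential_commutator:
  assumes "N \<ge> 2"
  shows "potential N (0, 0) (peak (Suc j) @ [Lb, La]) - potential N (0, 0) ([Lb, La] @ peak (Suc j))
    = peak_shift N (Suc j) - 1"
proof -
  have nd: "\<not> int N dvd 1"
    using assms by simp
  have d: "int N dvd peak_shift N (Suc j) - 1"
    by (simp add: peak_shift_Suc)
  have "\<not> int N dvd peak_shift N (Suc j)"
    using nd dvd_diff[OF _ d, of "peak_shift N (Suc j)"] by auto
  then have "potential N (1, 0) (peak (Suc j)) = 0"
    using nd a_weight_int[of N 2] a_weight_int[of N "1 + peak_shift N (Suc j)"]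
    by (simp add: potential_peak)
  moreover have "potential N (0, 0) (peak (Suc j)) = peak_shift N (Suc j) - 1"
    using d a_weight_int[of N 1] a_weight_int[of N "peak_shift N (Suc j)"]
    by (simp add: potential_peak)
  ultimately show ?thesis
    unfolding potential_append by simp
qed

section \<open>The exponential lower bound\<close>

lemma dehn_ge_deriv_dist:
  assumes "(u, v) \<in> mon_eq R" "length u + length v \<le> n"
  shows "deriv_dist R u v \<le> dehn R n"
  unfolding dehn_def using assms by (intro Max_ge finite_dehn_set) blast

text \<open>The bound \<open>8 * k + 8\<close> is the total length of the two words,
  \<open>4 * k + 4\<close> each.\<close>

lemma dehn_lower_bound:
  assumes "N \<ge> 2" "8 * k + 8 \<le> n"
  shows "real N ^ (2 * k) \<le> (real N + 1) * real (dehn (Pi_pres N) n) + 1"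
proof -
  let ?u = "peak (2 * k + 1) @ [Lb, La]" and ?v = "[Lb, La] @ peak (2 * k + 1)"
  let ?X = "real_of_int (peak_shift N (2 * k + 1))" and ?D = "real (dehn (Pi_pres N) n)"
  have eq: "(?u, ?v) \<in> mon_eq (Pi_pres N)"
    using assms(1) by (intro mon_eq.sym[OF ba_commutes_peak_odd]) simp
  have "?X - 1 \<le> \<bar>potential N (0, 0) ?u - potential N (0, 0) ?v\<bar>"
    using potential_commutator[OF assms(1), of "2 * k"] by simp
  also have "\<dots> \<le> real N * real (deriv_dist (Pi_pres N) ?u ?v)"
    using assms(1) by (intro potential_deriv_dist eq) simp
  also have "\<dots> \<le> real N * ?D"
    using assms(2) by (intro mult_left_mono of_nat_mono dehn_ge_deriv_dist eq) (simp_all add: peak_def)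
  finally have "(real N + 1) * (?X - 1) \<le> (real N + 1) * (real N * ?D)"
    by (intro mult_left_mono) simp_all
  moreover have "(real N + 1) * ?X = real N ^ (2 * k + 1) + 1"
    using arg_cong[OF peak_shift_odd[of N k], of real_of_int] by simp
  \<comment> \<open>The constants combine to \<open>-N\<close>, so a factor \<open>N\<close> can be
    cancelled.\<close>
  ultimately have "real N * real N ^ (2 * k) \<le> real N * ((real N + 1) * ?D + 1)"
    by (simp add: algebra_simps)
  then show ?thesis
    using assms(1) by simp
qed

theorem theorem1:
  fixes N :: nat
  assumes "N \<ge> 2"
  shows "(\<lambda>n. real (dehn (Pi_pres N) n)) \<succeq> (\<lambda>n. real N powr (real n / 4))"
  unfolding dominated_by_def
proof (intro exI conjI allI impI)
  \<comment> \<open>The lower bound is used with \<open>k = n\<close>: the factor 16 covers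
    \<open>8 * n + 8\<close> as \<open>n \<ge> 1\<close>, and \<open>N + 1\<close> covers the
    coefficient of the Dehn function.\<close>
  let ?c = "16 * (N + 1)"
  show "1 \<le> ?c" by simp
  fix n :: nat assume n: "1 \<le> n"
  let ?D = "real (dehn (Pi_pres N) (?c * n))"
  have "real N powr (real n / 4) \<le> real N powr real (2 * n)"
    using assms by (intro powr_mono) simp_all
  also have "\<dots> = real N ^ (2 * n)"
    using assms by (simp add: powr_realpow del: of_nat_mult)
  also have "\<dots> \<le> (real N + 1) * ?D + 1"
    using n by (intro dehn_lower_bound[OF assms]) (simp add: algebra_simps)
  also have "\<dots> \<le> real ?c * ?D + real (?c * n)"
  proof (rule add_mono)
    show "(real N + 1) * ?D \<le> real ?c * ?D"
      by (intro mult_right_mono) simp_all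
    show "1 \<le> real (?c * n)"
      using n by (simp del: of_nat_mult of_nat_add)
  qed
  finally show "real N powr (real n / 4) \<le> real ?c * ?D + real (?c * n)" .
qed

end
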